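(* Spectral expansion does not imply long-range expansion. More precisely, let $d\ge3$ and let $(H_m)$ be a sequence of $d$-regular graphs with $|V(H_m)|\to\infty$ that is a spectral expander sequence. Let $G_m$ be the $(d+1)$-regular graph consisting of two disjoint copies of $H_m$ together with an edge joining each vertex to its counterpart in the other copy. Then $(G_m)$ is a spectral expander sequence, but it is not a long-range expander sequence (of degree $d+1$): there is no $c>0$ such that every $G_m$ is a $c$-long-range expander.
   Context: All graphs are finite, simple and connected. For a $k$-regular graph $G=(V,E)$ with $k\ge 3$ and $n=|V|$, let $A$ be the adjacency matrix and $P=A/k$, with eigenvalues $1=\lambda_1(P)>\lambda_2(P)\ge\cdots\ge\lambda_n(P)\ge-1$. A sequence of $k$-regular graphs is a spectral expander sequence if there is a constant $\gamma>0$ with $1-\lambda_2(P)\ge\gamma$ for every graph in it. For $S\subseteq V$ and integer $r\ge0$, $B(S,r)=\{y\in V:\operatorname{dist}(y,S)\le r\}$. For $c\in(0,1]$, a $k$-regular graph $G$ is a $c$-long-range expander if $|B(S,r)|\ge\min\{3n/4,\ c|S|(k-1)^r\}$ for every $S\subseteq V$ and integer $r\ge0$. A sequence of $k$-regular graphs is a long-range expander sequence if the same $c>0$ works for every graph in it. *)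

theory Defs
  imports "Graph_Theory.Graph_Theory" "Jordan_Normal_Form.Char_Poly"
begin

text \<open>
  A finite simple graph is a \<^locale>\<open>pair_graph\<close>: a finite loop-free digraph whose arc set is a
  symmetric relation, so an edge is a pair of opposite arcs and the degree of a vertex is its
  out-degree.
\<close>

definition regular_graph :: "nat \<Rightarrow> 'a pair_pre_digraph \<Rightarrow> bool" where
  "regular_graph k G \<longleftrightarrow>
     pair_graph G \<and> Digraph_Component.connected (with_proj G) \<and>
     (\<forall>v \<in> pverts G. out_degree (with_proj G) v = k)"

text \<open>
  Matrices are indexed by natural numbers, so an enumeration of the vertices is chosen. Another
  choice conjugates the matrix by a permutation matrix and leaves the spectrum unchanged.
\<close>

definition vertex_list :: "'a pair_pre_digraph \<Rightarrow> 'a list" where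
  "vertex_list G = (SOME vs. distinct vs \<and> set vs = pverts G)"

definition adjacency_mat :: "'a pair_pre_digraph \<Rightarrow> real mat" where
  "adjacency_mat G =
     (let vs = vertex_list G; n = card (pverts G)
      in mat n n (\<lambda>(i, j). if (vs ! i, vs ! j) \<in> parcs G then 1 else 0))"

definition transition_mat :: "nat \<Rightarrow> 'a pair_pre_digraph \<Rightarrow> real mat" where
  "transition_mat k G = (1 / real k) \<cdot>\<^sub>m adjacency_mat G"

text \<open>
  The real eigenvalues in non-increasing order, repeated according to algebraic multiplicity.
  For a symmetric real matrix these are all the eigenvalues. Lists are indexed from 0, so the
  second largest eigenvalue is at position 1.
\<close>

definition eigenvalues_desc :: "real mat \<Rightarrow> real list" where
  "eigenvalues_desc M = rev (sorted_list_of_multiset (proots (char_poly M)))"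

definition lambda2 :: "real mat \<Rightarrow> real" where
  "lambda2 M = eigenvalues_desc M ! 1"

definition spectral_expander_seq :: "nat \<Rightarrow> (nat \<Rightarrow> 'a pair_pre_digraph) \<Rightarrow> bool" where
  "spectral_expander_seq k G \<longleftrightarrow>
     (\<forall>m. regular_graph k (G m)) \<and>
     (\<exists>\<gamma>>0. \<forall>m. 1 - lambda2 (transition_mat k (G m)) \<ge> \<gamma>)"

text \<open>The graph distance is the shortest-path weight for unit arc weights.\<close>

definition graph_dist :: "'a pair_pre_digraph \<Rightarrow> 'a \<Rightarrow> 'a \<Rightarrow> ereal" where
  "graph_dist G u v = wf_digraph.\<mu> (with_proj G) (\<lambda>_. 1) u v"

definition set_dist :: "'a pair_pre_digraph \<Rightarrow> 'a \<Rightarrow> 'a set \<Rightarrow> ereal" where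
  "set_dist G y S = (INF s \<in> S. graph_dist G y s)"

definition graph_ball :: "'a pair_pre_digraph \<Rightarrow> 'a set \<Rightarrow> nat \<Rightarrow> 'a set" where
  "graph_ball G S r = {y \<in> pverts G. set_dist G y S \<le> ereal (real r)}"

text \<open>
  The constant \<open>c\<close> is not restricted to \<open>(0,1]\<close> here. This does not affect the notion of a
  long-range expander sequence, since the inequality for some \<open>c\<close> implies it for every
  smaller one.
\<close>

definition long_range_expander :: "real \<Rightarrow> nat \<Rightarrow> 'a pair_pre_digraph \<Rightarrow> bool" where
  "long_range_expander c k G \<longleftrightarrow>
     regular_graph k G \<and>
     (\<forall>S r. S \<subseteq> pverts G \<longrightarrow>
        real (card (graph_ball G S r)) \<ge>
          min (3 * real (card (pverts G)) / 4) (c * real (card S) * (real k - 1) ^ r))"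

definition long_range_expander_seq :: "nat \<Rightarrow> (nat \<Rightarrow> 'a pair_pre_digraph) \<Rightarrow> bool" where
  "long_range_expander_seq k G \<longleftrightarrow> (\<exists>c>0. \<forall>m. long_range_expander c k (G m))"

text \<open>Two disjoint copies of a graph, with every vertex joined to its counterpart.\<close>

definition doubled_graph :: "'a pair_pre_digraph \<Rightarrow> ('a \<times> bool) pair_pre_digraph" where
  "doubled_graph H =
     \<lparr> pverts = pverts H \<times> UNIV,
       parcs = {((u, b), (v, b)) | u v b. (u, v) \<in> parcs H} \<union>
               {((v, b), (v, \<not> b)) | v b. v \<in> pverts H} \<rparr>"

end

theory Submission
  imports Defs
begin

text \<open>
  Order the vertices of the doubled graph copy by copy. Its adjacency matrix is then the block
  matrix with \<open>A\<close> on the diagonal and the identity off it, where \<open>A\<close> is the adjacency matrix of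
  \<open>H\<close>. The blocks commute, so the characteristic polynomial at \<open>x\<close> is
  \<open>det ((x I - A)\<^sup>2 - I) = \<chi> (x - 1) * \<chi> (x + 1)\<close> with \<open>\<chi>\<close> the characteristic polynomial
  of \<open>A\<close> (\<open>char_poly_block_shift\<close>). Every eigenvalue \<open>\<alpha>\<close> of \<open>H\<close> thus gives two eigenvalues
  \<open>\<alpha> + 1\<close> and \<open>\<alpha> - 1\<close>. As \<open>d\<close> is the largest eigenvalue of \<open>H\<close>, the second largest one of the
  doubled graph is at most the maximum of \<open>\<alpha>\<^sub>2 + 1\<close> and \<open>d - 1\<close>
  (\<open>lambda2_doubled_graph_le\<close>). A gap \<open>\<gamma>\<close> for \<open>H\<close> therefore becomes a gap
  \<open>min (d * \<gamma>) 2 / (d + 1)\<close>.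

  Long-range expansion fails already for single vertices. A walk in the doubled graph projects to
  a walk in \<open>H\<close> that is no longer, so a ball of radius \<open>r\<close> has at most twice as many vertices as
  one in the \<open>d\<close>-regular graph \<open>H\<close>, which is \<open>O((d - 1)^r)\<close>
  (\<open>card_graph_ball_doubled_graph\<close>). Degree \<open>d + 1\<close> would call for \<open>c * d^r\<close> vertices, as long as
  this is less than three quarters of all of them. Fix a radius at which \<open>c * d^r\<close> exceeds the
  upper bound; in a sufficiently large graph of the sequence the cap of three quarters exceeds that
  bound too, a contradiction.

  The spectrum is handled as the multiset of roots of the characteristic polynomial. If
  there are at least two roots, \<open>lambda2 M \<le> t\<close> says that at most one of them, counted with
  multiplicity, exceeds \<open>t\<close>, and such counts transfer directly along the shifts by \<open>1\<close> and
  \<open>- 1\<close> (\<open>size_filter_gt_lambda2_le\<close>, \<open>lambda2_le\<close>).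
\<close>

section \<open>Roots of polynomials under affine substitution\<close>

lemma order_pcompose_linear:
  fixes p :: "'a :: field poly"
  assumes "a \<noteq> 0" "p \<noteq> 0"
  shows "Polynomial.order x (pcompose p [:b, a:]) = Polynomial.order (a * x + b) p"
proof -
  \<comment> \<open>Split off the full power of \<open>X - y\<close>; the substitution turns it into a multiple of \<open>X - x\<close>.\<close>
  define y where "y = a * x + b"
  obtain q where q: "p = [:-y, 1:] ^ Polynomial.order y p * q" "\<not> [:-y, 1:] dvd q"
    using order_decomp[OF assms(2)] by blast
  have lin: "pcompose [:-y, 1:] [:b, a:] = Polynomial.smult a [:-x, 1:]"
    using assms(1) by (simp add: pcompose_pCons y_def)
  have "pcompose p [:b, a:] = Polynomial.smult a [:-x, 1:] ^ Polynomial.order y p * pcompose q [:b, a:]"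
    by (subst q(1)) (simp only: pcompose_mult pcompose_hom.hom_power lin)
  also have "\<dots> = Polynomial.smult (a ^ Polynomial.order y p) ([:-x, 1:] ^ Polynomial.order y p * pcompose q [:b, a:])"
    unfolding smult_power by simp
  finally have eq: "pcompose p [:b, a:] = \<dots>" .
  have "poly (pcompose q [:b, a:]) x \<noteq> 0"
    using q(2) by (simp add: poly_pcompose y_def poly_eq_0_iff_dvd mult.commute add.commute)
  then have "Polynomial.order x (pcompose q [:b, a:]) = 0" "pcompose q [:b, a:] \<noteq> 0"
    by (auto intro: order_0I)
  then show ?thesis
    unfolding eq y_def[symmetric] using assms(1)
    by (subst order_smult) (auto simp: order_mult order_power_n_n)
qed

lemma proots_pcompose_linear:
  fixes p :: "'a :: field poly"
  assumes "a \<noteq> 0" "p \<noteq> 0"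
  shows "proots (pcompose p [:b, a:]) = image_mset (\<lambda>y. (y - b) / a) (proots p)"
proof (rule multiset_eqI)
  fix x
  have "pcompose p [:b, a:] \<noteq> 0"
    using assms by (simp add: pcompose_eq_0_iff)
  moreover have "(\<lambda>y. (y - b) / a) -` {x} = {a * x + b}"
    using assms(1) by (auto simp: field_simps)
  moreover have "set_mset (proots p) \<inter> {a * x + b} = (if a * x + b \<in># proots p then {a * x + b} else {})"
    by auto
  ultimately show "count (proots (pcompose p [:b, a:])) x =
      count (image_mset (\<lambda>y. (y - b) / a) (proots p)) x"
    using assms by (auto simp: count_image_mset order_pcompose_linear Int_commute order_0I)
qed

section \<open>Characteristic polynomials\<close>

lemma char_poly_nonzero:
  fixes A :: "'a :: comm_ring_1 mat"
  assumes "A \<in> carrier_mat n n"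
  shows "char_poly A \<noteq> 0"
  using degree_monic_char_poly[OF assms] by auto

lemma poly_char_poly:
  fixes A :: "'a :: field mat"
  assumes "A \<in> carrier_mat n n"
  shows "poly (char_poly A) x = det (x \<cdot>\<^sub>m 1\<^sub>m n - A)"
proof -
  have "- char_matrix A x = x \<cdot>\<^sub>m 1\<^sub>m n - A"
    using assms by (intro eq_matI) (auto simp: char_matrix_def)
  then show ?thesis
    by (simp add: char_poly_matrix[OF assms])
qed

lemma proots_char_poly_smult:
  fixes A :: "real mat"
  assumes A: "A \<in> carrier_mat n n" and c: "c \<noteq> 0"
  shows "proots (char_poly (c \<cdot>\<^sub>m A)) = image_mset (\<lambda>x. c * x) (proots (char_poly A))"
proof -
  have "poly (char_poly (c \<cdot>\<^sub>m A)) x = poly (Polynomial.smult (c ^ n) (pcompose (char_poly A) [:0, 1 / c:])) x" for x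
  proof -
    have "x \<cdot>\<^sub>m 1\<^sub>m n - c \<cdot>\<^sub>m A = c \<cdot>\<^sub>m ((x / c) \<cdot>\<^sub>m 1\<^sub>m n - A)"
      using A c by (intro eq_matI) (auto simp: field_simps)
    moreover have "dim_col ((x / c) \<cdot>\<^sub>m 1\<^sub>m n - A) = n" using A by auto
    ultimately show ?thesis
      using A by (simp add: poly_char_poly[of _ n] poly_pcompose)
  qed
  then have "char_poly (c \<cdot>\<^sub>m A) = Polynomial.smult (c ^ n) (pcompose (char_poly A) [:0, 1 / c:])"
    by (simp add: poly_eq_poly_eq_iff[symmetric] fun_eq_iff)
  then show ?thesis
    using c char_poly_nonzero[OF A]
    by (simp add: proots_pcompose_linear mult.commute)
qed

text \<open>
  Rows and columns are permuted one after the other, and the two signs cancel.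
\<close>

lemma char_poly_permute:
  fixes A :: "'a :: comm_ring_1 mat"
  assumes A: "A \<in> carrier_mat n n" and p: "p permutes {0..<n}"
  shows "char_poly (mat n n (\<lambda>(i, j). A $$ (p i, p j))) = char_poly A"
proof -
  define C where "C = char_poly_matrix A"
  have C: "C \<in> carrier_mat n n" using A by (simp add: C_def)
  define D where "D = mat n n (\<lambda>(i, j). C $$ (p i, j))"
  have D: "D \<in> carrier_mat n n" by (simp add: D_def)
  have pn: "p i < n" if "i < n" for i
    using permutes_in_image[OF p, of i] that by simp
  have pinj: "p i = p j \<longleftrightarrow> i = j" for i j
    using permutes_inj[OF p] by (auto dest: injD)
  have "char_poly_matrix (mat n n (\<lambda>(i, j). A $$ (p i, p j))) =
      transpose_mat (mat n n (\<lambda>(i, j). transpose_mat D $$ (p i, j)))"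
    using A pn by (intro eq_matI) (auto simp: D_def C_def char_poly_matrix_def pinj)
  then have "char_poly (mat n n (\<lambda>(i, j). A $$ (p i, p j))) =
      det (mat n n (\<lambda>(i, j). transpose_mat D $$ (p i, j)))"
    by (simp add: char_poly_def det_transpose[of _ n])
  also have "\<dots> = signof p * det (transpose_mat D)"
    using D by (intro det_permute_rows[OF _ p]) simp
  also have "det (transpose_mat D) = signof p * det C"
    unfolding det_transpose[OF D] unfolding D_def by (rule det_permute_rows[OF C p])
  also have "signof p * (signof p * det C) = char_poly A"
    by (auto simp: sign_def C_def char_poly_def)
  finally show ?thesis .
qed

text \<open>
  All four blocks of \<open>x I - M\<close> commute, so its determinant is that of
  \<open>X\<^sup>2 - I = (X - I) (X + I)\<close> with \<open>X = x I - A\<close>. Comparing values at all real \<open>x\<close> keeps the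
  computation inside real matrices and avoids matrices of polynomials.
\<close>

lemma char_poly_block_shift:
  fixes A :: "real mat"
  assumes A: "A \<in> carrier_mat n n"
  shows "char_poly (four_block_mat A (1\<^sub>m n) (1\<^sub>m n) A) =
    pcompose (char_poly A) [:-1, 1:] * pcompose (char_poly A) [:1, 1:]"
proof -
  have "poly (char_poly (four_block_mat A (1\<^sub>m n) (1\<^sub>m n) A)) x =
    poly (pcompose (char_poly A) [:-1, 1:] * pcompose (char_poly A) [:1, 1:]) x" for x
  proof -
    define X where "X = x \<cdot>\<^sub>m 1\<^sub>m n - A"
    have X: "X \<in> carrier_mat n n" using A by (auto simp: X_def minus_carrier_mat)
    have "x \<cdot>\<^sub>m 1\<^sub>m (n + n) - four_block_mat A (1\<^sub>m n) (1\<^sub>m n) A =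
        four_block_mat X (- 1\<^sub>m n) (- 1\<^sub>m n) X"
      using A by (intro eq_matI) (auto simp: X_def)
    then have "poly (char_poly (four_block_mat A (1\<^sub>m n) (1\<^sub>m n) A)) x =
        det (four_block_mat X (- 1\<^sub>m n) (- 1\<^sub>m n) X)"
      using A by (simp add: poly_char_poly[of _ "n + n"])
    also have "\<dots> = det (X * X - (- 1\<^sub>m n) * (- 1\<^sub>m n))"
      using X by (intro det_four_block_mat) auto
    also have "X * X - (- 1\<^sub>m n) * (- 1\<^sub>m n) = (X - 1\<^sub>m n) * (X + 1\<^sub>m n)"
    proof -
      have "(X - 1\<^sub>m n) * (X + 1\<^sub>m n) = X * (X + 1\<^sub>m n) - 1\<^sub>m n * (X + 1\<^sub>m n)"
        using X by (intro minus_mult_distrib_mat) auto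
      also have "X * (X + 1\<^sub>m n) = X * X + X"
        using X by (subst mult_add_distrib_mat[of _ n n]) auto
      finally show ?thesis
        using X by (intro eq_matI) auto
    qed
    also have "det \<dots> = det (X - 1\<^sub>m n) * det (X + 1\<^sub>m n)"
      using X by (intro det_mult[of _ n]) auto
    also have "X - 1\<^sub>m n = (x - 1) \<cdot>\<^sub>m 1\<^sub>m n - A"
      using A by (intro eq_matI) (auto simp: X_def)
    also have "X + 1\<^sub>m n = (x + 1) \<cdot>\<^sub>m 1\<^sub>m n - A"
      using A by (intro eq_matI) (auto simp: X_def)
    finally show ?thesis
      using A by (simp add: poly_char_poly poly_pcompose add.commute)
  qed
  then show ?thesis
    by (simp add: poly_eq_poly_eq_iff[symmetric] fun_eq_iff)
qed

section \<open>The second largest eigenvalue\<close>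

lemma size_filter_sorted_list_of_multiset:
  "size (filter_mset P M) = length (filter P (sorted_list_of_multiset M))"
  by (metis mset_filter mset_sorted_list_of_multiset size_mset)

text \<open>
  In a descending list only the head can exceed the entry at position 1. A list with fewer than two
  entries has no such entry, but then the bound is trivial for any value of \<open>lambda2\<close>.
\<close>

lemma size_filter_gt_lambda2_le:
  "size {#x \<in># proots (char_poly M). lambda2 M < x#} \<le> 1"
proof (cases "eigenvalues_desc M")
  case Nil
  then show ?thesis
    by (simp add: size_filter_sorted_list_of_multiset eigenvalues_desc_def)
next
  case (Cons a xs)
  have "size {#x \<in># proots (char_poly M). lambda2 M < x#} =
      length (filter (\<lambda>x. lambda2 M < x) (a # xs))"
    unfolding Cons[symmetric] eigenvalues_desc_def
    by (simp add: size_filter_sorted_list_of_multiset flip: rev_filter)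
  moreover have "filter (\<lambda>x. lambda2 M < x) xs = []"
  proof (cases xs)
    case (Cons b ys)
    have "sorted (rev (eigenvalues_desc M))"
      by (simp add: eigenvalues_desc_def)
    then have "\<forall>y\<in>set xs. y \<le> b"
      using \<open>eigenvalues_desc M = a # xs\<close> Cons by (auto simp: sorted_append)
    moreover have "lambda2 M = b"
      using \<open>eigenvalues_desc M = a # xs\<close> Cons by (simp add: lambda2_def)
    ultimately show ?thesis by (force simp: filter_empty_conv)
  qed simp
  ultimately show ?thesis by simp
qed

text \<open>
  The converse needs two roots: otherwise \<open>lambda2\<close> is an arbitrary number.
\<close>

lemma lambda2_le:
  assumes "size {#x \<in># proots (char_poly M). t < x#} \<le> 1"
    and "2 \<le> size (proots (char_poly M))"
  shows "lambda2 M \<le> t"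
proof (rule ccontr)
  assume *: "\<not> lambda2 M \<le> t"
  have "length (eigenvalues_desc M) = size (proots (char_poly M))"
    unfolding eigenvalues_desc_def
    by (metis length_rev mset_sorted_list_of_multiset size_mset)
  with assms(2) obtain a b xs where ab: "eigenvalues_desc M = a # b # xs"
    by (metis (no_types, lifting) One_nat_def Suc_1 Suc_le_length_iff)
  have "sorted (rev (eigenvalues_desc M))"
    by (simp add: eigenvalues_desc_def)
  with ab * have "t < a" "t < b"
    by (auto simp: sorted_append lambda2_def)
  moreover have "size {#x \<in># proots (char_poly M). t < x#} =
      length (filter (\<lambda>x. t < x) (a # b # xs))"
    unfolding ab[symmetric] eigenvalues_desc_def
    by (simp add: size_filter_sorted_list_of_multiset flip: rev_filter)
  ultimately show False using assms(1) by simp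
qed

section \<open>Adjacency matrices\<close>

text \<open>
  The vertex order is made explicit because \<open>vertex_list\<close> is a choice: for the doubled graph the
  chosen list can be replaced by one that runs through the two copies in turn.
\<close>

definition adjacency_along :: "('a \<times> 'a) set \<Rightarrow> 'a list \<Rightarrow> real mat" where
  "adjacency_along E vs =
     mat (length vs) (length vs) (\<lambda>(i, j). if (vs ! i, vs ! j) \<in> E then 1 else 0)"

lemma adjacency_along_carrier [simp]:
  "adjacency_along E vs \<in> carrier_mat (length vs) (length vs)"
  by (simp add: adjacency_along_def)

lemma char_poly_adjacency_along_cong:
  assumes "distinct vs" "distinct ws" "set vs = set ws"
  shows "char_poly (adjacency_along E vs) = char_poly (adjacency_along E ws)"
proof -
  have "mset vs = mset ws"
    using assms by (simp add: set_eq_iff_mset_eq_distinct)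
  then obtain p where p: "p permutes {..<length ws}" "permute_list p ws = vs"
    by (rule mset_eq_permutation)
  have len: "length vs = length ws" using p(2) by auto
  have p': "p permutes {0..<length ws}" using p(1) by (simp add: atLeast0LessThan)
  have pn: "p i < length ws" if "i < length ws" for i
    using permutes_in_image[OF p', of i] that by simp
  have "adjacency_along E vs =
      mat (length ws) (length ws) (\<lambda>(i, j). adjacency_along E ws $$ (p i, p j))"
  proof (rule eq_matI, goal_cases)
    case (1 i j)
    then have "vs ! i = ws ! p i" "vs ! j = ws ! p j"
      using permute_list_nth[OF p(1)] p(2) by simp_all
    with 1 pn show ?case by (simp add: adjacency_along_def len)
  qed (simp_all add: adjacency_along_def len)
  then show ?thesis
    by (simp add: char_poly_permute[OF _ p'])
qed

lemma vertex_list: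
  assumes "finite (pverts G)"
  shows "distinct (vertex_list G)" "set (vertex_list G) = pverts G"
proof -
  have "\<exists>vs. distinct vs \<and> set vs = pverts G"
    using finite_distinct_list[OF assms] by blast
  then have "distinct (vertex_list G) \<and> set (vertex_list G) = pverts G"
    unfolding vertex_list_def by (rule someI_ex)
  then show "distinct (vertex_list G)" "set (vertex_list G) = pverts G" by auto
qed

lemma adjacency_mat_eq_along:
  assumes "finite (pverts G)"
  shows "adjacency_mat G = adjacency_along (parcs G) (vertex_list G)"
  using vertex_list[OF assms]
  by (simp add: adjacency_mat_def adjacency_along_def Let_def flip: distinct_card)

lemma adjacency_mat_carrier:
  "adjacency_mat G \<in> carrier_mat (card (pverts G)) (card (pverts G))"
  by (simp add: adjacency_mat_def Let_def)

lemma card_neighbours: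
  assumes "regular_graph k G" "v \<in> pverts G"
  shows "card {u. (v, u) \<in> parcs G} = k"
proof -
  have "out_arcs (with_proj G) v = Pair v ` {u. (v, u) \<in> parcs G}"
    by (auto simp: out_arcs_def)
  then have "out_degree (with_proj G) v = card {u. (v, u) \<in> parcs G}"
    by (simp add: out_degree_def card_image inj_on_def)
  with assms show ?thesis by (simp add: regular_graph_def)
qed

lemma adjacency_row_sum:
  assumes G: "regular_graph k G" and i: "i < card (pverts G)"
  shows "(\<Sum>j<card (pverts G). adjacency_mat G $$ (i, j)) = real k"
proof -
  interpret pair_graph G using G by (simp add: regular_graph_def)
  define vs where "vs = vertex_list G"
  note vs = vertex_list[OF pair_finite_verts, folded vs_def]
  have len: "length vs = card (pverts G)"
    using vs by (metis distinct_card)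
  have "vs ! i \<in> pverts G"
    unfolding vs(2)[symmetric] using i len by simp
  have "(\<Sum>j<card (pverts G). adjacency_mat G $$ (i, j)) =
      (\<Sum>j<length vs. if (vs ! i, vs ! j) \<in> parcs G then 1 else 0)"
    using i by (intro sum.cong) (simp_all add: len adjacency_mat_def Let_def flip: vs_def)
  also have "\<dots> = (\<Sum>u\<in>pverts G. if (vs ! i, u) \<in> parcs G then 1 else 0)"
    using bij_betw_nth[OF vs(1) refl refl] unfolding vs(2)
    by (rule sum.reindex_bij_betw)
  also have "\<dots> = real (card (pverts G \<inter> {u. (vs ! i, u) \<in> parcs G}))"
    using pair_finite_verts by (simp add: sum.If_cases)
  also have "pverts G \<inter> {u. (vs ! i, u) \<in> parcs G} = {u. (vs ! i, u) \<in> parcs G}"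
    using in_arcsD2 by blast
  finally show ?thesis
    using card_neighbours[OF G \<open>vs ! i \<in> pverts G\<close>] by simp
qed

text \<open>
  The all-ones vector is an eigenvector, since all row sums equal the degree.
\<close>

lemma degree_in_proots:
  assumes G: "regular_graph k G"
  shows "real k \<in># proots (char_poly (adjacency_mat G))"
proof -
  interpret pair_graph G using G by (simp add: regular_graph_def)
  define n where "n = card (pverts G)"
  note A = adjacency_mat_carrier[of G, folded n_def]
  have "pverts G \<noteq> {}"
    using G by (simp add: regular_graph_def connected_conv)
  then have "n > 0"
    using pair_finite_verts by (simp add: n_def card_gt_0_iff)
  define v where "v = vec n (\<lambda>_. 1 :: real)"
  have "v \<noteq> 0\<^sub>v n"
  proof
    assume "v = 0\<^sub>v n"
    then have "v $ 0 = 0\<^sub>v n $ 0" by simp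
    with \<open>n > 0\<close> show False by (simp add: v_def)
  qed
  moreover have "adjacency_mat G *\<^sub>v v = real k \<cdot>\<^sub>v v"
    using A adjacency_row_sum[OF G, folded n_def]
    by (intro eq_vecI) (auto simp: v_def scalar_prod_def lessThan_atLeast0)
  moreover have "v \<in> carrier_vec n" by (simp add: v_def)
  ultimately have "eigenvalue (adjacency_mat G) (real k)"
    using A unfolding eigenvalue_def eigenvector_def by auto
  then show ?thesis
    using A char_poly_nonzero[OF A] by (simp add: eigenvalue_root_char_poly)
qed

text \<open>
  At an entry of maximal absolute value of an eigenvector, the eigenvalue equation has absolute value
  at most the row sum times this maximum.
\<close>

lemma proots_le_degree:
  assumes G: "regular_graph k G" and r: "r \<in># proots (char_poly (adjacency_mat G))"
  shows "r \<le> real k"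
proof -
  define n where "n = card (pverts G)"
  define A where "A = adjacency_mat G"
  have A: "A \<in> carrier_mat n n"
    using adjacency_mat_carrier by (simp add: A_def n_def)
  have nn: "0 \<le> A $$ (i, j)" if "i < n" "j < n" for i j
    using that by (simp add: A_def n_def adjacency_mat_def Let_def)
  have "eigenvalue A r"
    using r char_poly_nonzero[OF A] by (simp add: eigenvalue_root_char_poly[OF A] flip: A_def)
  then obtain v where v: "v \<in> carrier_vec n" "v \<noteq> 0\<^sub>v n" "A *\<^sub>v v = r \<cdot>\<^sub>v v"
    using A by (auto simp: eigenvalue_def eigenvector_def)
  obtain i where i: "i < n" "v $ i \<noteq> 0"
    using v(1,2) by (auto simp: vec_eq_iff)
  define m where "m = Max ((\<lambda>i. \<bar>v $ i\<bar>) ` {..<n})"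
  have "m \<in> (\<lambda>i. \<bar>v $ i\<bar>) ` {..<n}"
    unfolding m_def using i by (intro Max_in) auto
  then obtain j where j: "j < n" "m = \<bar>v $ j\<bar>" by auto
  have max: "\<bar>v $ l\<bar> \<le> m" if "l < n" for l
    unfolding m_def using that by (intro Max_ge) auto
  with i have "m > 0" by fastforce
  have "r * v $ j = (A *\<^sub>v v) $ j"
    using v j by simp
  also have "\<dots> = (\<Sum>l<n. A $$ (j, l) * v $ l)"
    using A v(1) j by (simp add: scalar_prod_def lessThan_atLeast0)
  finally have "\<bar>r\<bar> * m = \<bar>\<Sum>l<n. A $$ (j, l) * v $ l\<bar>"
    by (simp add: j(2) flip: abs_mult)
  also have "\<dots> \<le> (\<Sum>l<n. \<bar>A $$ (j, l) * v $ l\<bar>)"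
    by (rule sum_abs)
  also have "\<dots> \<le> (\<Sum>l<n. A $$ (j, l) * m)"
    using j(1) nn max by (intro sum_mono) (auto simp: abs_mult intro!: mult_left_mono)
  also have "\<dots> = real k * m"
    using adjacency_row_sum[OF G, of j] j(1) by (simp add: A_def n_def flip: sum_distrib_right)
  finally show ?thesis using \<open>m > 0\<close> by simp
qed

lemma proots_transition_mat:
  assumes "k > 0"
  shows "proots (char_poly (transition_mat k G)) =
    image_mset (\<lambda>x. x / real k) (proots (char_poly (adjacency_mat G)))"
  unfolding transition_mat_def using assms
  by (simp add: proots_char_poly_smult[OF adjacency_mat_carrier])

section \<open>The doubled graph is regular\<close>

lemma arc_doubled_graph:
  "((u, b), (v, c)) \<in> parcs (doubled_graph H) \<longleftrightarrow>
     (u, v) \<in> parcs H \<and> b = c \<or> u = v \<and> c = (\<not> b) \<and> u \<in> pverts H"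
  by (auto simp: doubled_graph_def)

lemma pverts_doubled_graph: "pverts (doubled_graph H) = pverts H \<times> UNIV"
  by (simp add: doubled_graph_def)

lemma pair_graph_doubled_graph:
  assumes "pair_graph H"
  shows "pair_graph (doubled_graph H)"
proof -
  interpret pair_graph H by fact
  show ?thesis
  proof unfold_locales
    show wf: "fst e \<in> pverts (doubled_graph H)" "snd e \<in> pverts (doubled_graph H)"
      if "e \<in> parcs (doubled_graph H)" for e
      using that in_arcsD1 in_arcsD2 by (auto simp: doubled_graph_def)
    show fin: "finite (pverts (doubled_graph H))"
      by (simp add: pverts_doubled_graph pair_finite_verts)
    have "parcs (doubled_graph H) \<subseteq> pverts (doubled_graph H) \<times> pverts (doubled_graph H)"
      using wf by (auto simp: mem_Times_iff)
    then show "finite (parcs (doubled_graph H))"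
      using fin by (meson finite_SigmaI finite_subset)
    show "symmetric (with_proj (doubled_graph H))"
      using arcs_symmetric by (auto simp: symmetric_def sym_def arc_doubled_graph)
    show "fst e \<noteq> snd e" if "e \<in> parcs (doubled_graph H)" for e
      using that no_loops' by (auto simp: doubled_graph_def)
  qed
qed

lemma connected_doubled_graph:
  assumes "pair_graph H" "Digraph_Component.connected (with_proj H)"
  shows "Digraph_Component.connected (with_proj (doubled_graph H))"
proof -
  interpret pair_graph H by fact
  interpret G: pair_graph "doubled_graph H"
    using assms(1) by (rule pair_graph_doubled_graph)
  have copy: "(u, b) \<rightarrow>\<^sup>*\<^bsub>with_proj (doubled_graph H)\<^esub> (v, b)"
    if "u \<rightarrow>\<^sup>*\<^bsub>with_proj H\<^esub> v" for u v b
    using that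
  proof (induction rule: converse_reachable_induct)
    case base
    then show ?case by (intro G.reachable_refl) (simp add: pverts_doubled_graph)
  next
    case (step x y)
    then show ?case
      by (intro G.adj_reachable_trans[of "(x, b)" "(y, b)"]) (simp_all add: arc_doubled_graph)
  qed
  have sc: "strongly_connected (with_proj H)"
    using symmetric_connected_imp_strongly_connected[OF sym_arcs assms(2)] .
  have reach: "x \<rightarrow>\<^sup>*\<^bsub>with_proj (doubled_graph H)\<^esub> y"
    if xy: "x \<in> pverts (doubled_graph H)" "y \<in> pverts (doubled_graph H)" for x y
  proof -
    obtain u b v c where x: "x = (u, b)" "u \<in> pverts H" and y: "y = (v, c)" "v \<in> pverts H"
      using xy by (auto simp: pverts_doubled_graph)
    have "(u, b) \<rightarrow>\<^sup>*\<^bsub>with_proj (doubled_graph H)\<^esub> (v, b)"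
      using sc x y by (intro copy) (auto simp: strongly_connected_def)
    also have "(v, b) \<rightarrow>\<^sup>*\<^bsub>with_proj (doubled_graph H)\<^esub> (v, c)"
      using y by (cases "b = c")
        (auto simp: pverts_doubled_graph arc_doubled_graph intro!: G.reachable_adjI G.reachable_refl)
    finally show "x \<rightarrow>\<^sup>*\<^bsub>with_proj (doubled_graph H)\<^esub> y"
      by (simp add: x y)
  qed
  show ?thesis
    unfolding Digraph_Component.connected_def
  proof (rule strongly_connectedI)
    show "verts (with_proj (mk_symmetric (with_proj (doubled_graph H)))) \<noteq> {}"
      using sc by (auto simp: strongly_connected_def pverts_doubled_graph)
  qed (auto intro!: G.reachable_mk_symmetricI reach)
qed

lemma regular_graph_doubled_graph:
  assumes G: "regular_graph d H"
  shows "regular_graph (d + 1) (doubled_graph H)"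
  unfolding regular_graph_def
proof (intro conjI ballI)
  have H: "pair_graph H" "Digraph_Component.connected (with_proj H)"
    using G by (auto simp: regular_graph_def)
  interpret pair_graph H by fact
  show "pair_graph (doubled_graph H)"
    using H(1) by (rule pair_graph_doubled_graph)
  show "Digraph_Component.connected (with_proj (doubled_graph H))"
    using H by (rule connected_doubled_graph)
  fix x assume "x \<in> pverts (doubled_graph H)"
  then obtain v b where x: "x = (v, b)" and v: "v \<in> pverts H"
    by (auto simp: pverts_doubled_graph)
  have fin: "finite {u. (v, u) \<in> parcs H}"
    using pair_finite_verts by (rule rev_finite_subset) (auto dest: in_arcsD2)
  have "out_arcs (with_proj (doubled_graph H)) x =
      Pair x ` insert (v, \<not> b) ((\<lambda>u. (u, b)) ` {u. (v, u) \<in> parcs H})"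
    using v by (auto simp: out_arcs_def x arc_doubled_graph)
  then have "out_degree (with_proj (doubled_graph H)) x =
      card (insert (v, \<not> b) ((\<lambda>u. (u, b)) ` {u. (v, u) \<in> parcs H}))"
    by (simp only: out_degree_def) (rule card_image, simp add: inj_on_def)
  also have "\<dots> = Suc (card ((\<lambda>u. (u, b)) ` {u. (v, u) \<in> parcs H}))"
    using fin by (intro card_insert_disjoint) auto
  also have "\<dots> = d + 1"
    using card_neighbours[OF G v] by (simp add: card_image inj_on_def)
  finally show "out_degree (with_proj (doubled_graph H)) x = d + 1" .
qed

section \<open>The spectral gap of the doubled graph\<close>

lemma proots_char_poly_doubled:
  assumes G: "pair_graph H"
  shows "proots (char_poly (adjacency_mat (doubled_graph H))) =
    image_mset (\<lambda>x. x + 1) (proots (char_poly (adjacency_mat H))) +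
    image_mset (\<lambda>x. x - 1) (proots (char_poly (adjacency_mat H)))"
proof -
  interpret pair_graph H by fact
  define vs where "vs = vertex_list H"
  define n where "n = length vs"
  define ws where "ws = map (\<lambda>v. (v, False)) vs @ map (\<lambda>v. (v, True)) vs"
  define A where "A = adjacency_along (parcs H) vs"
  note vs = vertex_list[OF pair_finite_verts, folded vs_def]
  have A: "A \<in> carrier_mat n n" by (simp add: A_def n_def)
  have AH: "adjacency_mat H = A"
    by (simp add: adjacency_mat_eq_along pair_finite_verts A_def vs_def)
  have ws: "distinct ws" "set ws = pverts (doubled_graph H)"
    using vs by (auto simp: ws_def distinct_map inj_on_def doubled_graph_def)
  have fin: "finite (pverts (doubled_graph H))"
    by (simp add: doubled_graph_def pair_finite_verts)
  have "adjacency_along (parcs (doubled_graph H)) ws = four_block_mat A (1\<^sub>m n) (1\<^sub>m n) A"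
  proof (rule eq_matI)
    fix i j
    assume "i < dim_row (four_block_mat A (1\<^sub>m n) (1\<^sub>m n) A)"
      "j < dim_col (four_block_mat A (1\<^sub>m n) (1\<^sub>m n) A)"
    then have ij: "i < n + n" "j < n + n" using A by auto
    have *: "vs ! i \<in> pverts H" if "i < n" for i
      unfolding vs(2)[symmetric] using that by (simp add: n_def)
    show "adjacency_along (parcs (doubled_graph H)) ws $$ (i, j) =
        four_block_mat A (1\<^sub>m n) (1\<^sub>m n) A $$ (i, j)"
    proof (cases "i < n"; cases "j < n")
      assume "i < n" "j < n"
      then show ?thesis
        by (simp add: adjacency_along_def ws_def n_def A_def nth_append arc_doubled_graph)
    next
      assume c: "i < n" "\<not> j < n"
      then have "vs ! i = vs ! (j - n) \<longleftrightarrow> i = j - n"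
        using ij by (intro nth_eq_iff_index_eq[OF vs(1)]) (auto simp: n_def)
      with c ij * show ?thesis
        by (simp add: adjacency_along_def ws_def n_def A_def nth_append arc_doubled_graph)
    next
      assume c: "\<not> i < n" "j < n"
      then have "vs ! (i - n) = vs ! j \<longleftrightarrow> i - n = j"
        using ij by (intro nth_eq_iff_index_eq[OF vs(1)]) (auto simp: n_def)
      with c ij *[of j] show ?thesis
        by (simp add: adjacency_along_def ws_def n_def A_def nth_append arc_doubled_graph conj_commute)
    next
      assume "\<not> i < n" "\<not> j < n"
      with ij show ?thesis
        by (simp add: adjacency_along_def ws_def n_def A_def nth_append arc_doubled_graph)
    qed
  qed (auto simp: adjacency_along_def A_def ws_def n_def)
  then have "char_poly (adjacency_mat (doubled_graph H)) =
      pcompose (char_poly A) [:-1, 1:] * pcompose (char_poly A) [:1, 1:]"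
    using char_poly_adjacency_along_cong[OF vertex_list(1)[OF fin] ws(1)] vertex_list(2)[OF fin] ws(2)
      char_poly_block_shift[OF A]
    by (simp add: adjacency_mat_eq_along[OF fin])
  then show ?thesis
    using char_poly_nonzero[OF A]
    by (simp add: AH proots_mult proots_pcompose_linear pcompose_eq_0_iff)
qed

text \<open>
  A root of \<open>H\<close> shifted by \<open>+1\<close> exceeds the bound only if it exceeds \<open>d\<close> times \<open>lambda2\<close> of \<open>H\<close>,
  and at most one root does. A root shifted by \<open>-1\<close> never does, because it is at most \<open>d - 1\<close>.
\<close>

lemma lambda2_doubled_graph_le:
  assumes G: "regular_graph d H" and d: "d > 0"
  shows "lambda2 (transition_mat (d + 1) (doubled_graph H)) \<le>
    max (real d * lambda2 (transition_mat d H) + 1) (real d - 1) / (real d + 1)"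
proof (rule lambda2_le)
  define R where "R = proots (char_poly (adjacency_mat H))"
  define t where "t = max (real d * lambda2 (transition_mat d H) + 1) (real d - 1) / (real d + 1)"
  have H: "pair_graph H" using G by (simp add: regular_graph_def)
  have roots: "proots (char_poly (transition_mat (d + 1) (doubled_graph H))) =
      image_mset (\<lambda>x. (x + 1) / (real d + 1)) R + image_mset (\<lambda>x. (x - 1) / (real d + 1)) R"
    by (simp add: proots_transition_mat proots_char_poly_doubled[OF H] R_def
        multiset.map_comp comp_def add.commute)
  have "real d \<in># R" using degree_in_proots[OF G] by (simp add: R_def)
  then have "1 \<le> size R" by (metis One_nat_def Suc_leI empty_not_add_mset mset_add size_eq_0_iff_empty gr0I)
  then show "2 \<le> size (proots (char_poly (transition_mat (d + 1) (doubled_graph H))))"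
    unfolding roots by simp
  have "size {#x \<in># R. t < (x + 1) / (real d + 1)#} \<le> size {#x \<in># R. lambda2 (transition_mat d H) < x / real d#}"
  proof (intro size_mset_mono filter_mset_mono_strong)
    fix x assume "t < (x + 1) / (real d + 1)"
    then have "real d * lambda2 (transition_mat d H) + 1 < x + 1"
      by (simp add: t_def divide_less_cancel)
    then show "lambda2 (transition_mat d H) < x / real d"
      using d by (simp add: field_simps)
  qed simp
  also have "\<dots> = size {#x \<in># proots (char_poly (transition_mat d H)). lambda2 (transition_mat d H) < x#}"
    by (simp add: proots_transition_mat[OF d] filter_mset_image_mset R_def)
  also have "\<dots> \<le> 1" by (rule size_filter_gt_lambda2_le)
  finally have plus: "size {#x \<in># R. t < (x + 1) / (real d + 1)#} \<le> 1" .
  have minus: "{#x \<in># R. t < (x - 1) / (real d + 1)#} = {#}"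
  proof -
    have "\<not> t < (x - 1) / (real d + 1)" if "x \<in># R" for x
    proof -
      have "x - 1 \<le> real d - 1"
        using proots_le_degree[OF G, of x] that by (simp add: R_def)
      also have "\<dots> \<le> max (real d * lambda2 (transition_mat d H) + 1) (real d - 1)"
        by simp
      finally show ?thesis
        by (simp add: t_def not_less divide_right_mono)
    qed
    then show ?thesis by (auto simp: filter_mset_eq_conv)
  qed
  show "size {#x \<in># proots (char_poly (transition_mat (d + 1) (doubled_graph H))).
      max (real d * lambda2 (transition_mat d H) + 1) (real d - 1) / (real d + 1) < x#} \<le> 1"
    unfolding t_def[symmetric] roots
    by (simp only: filter_union_mset filter_mset_image_mset size_union size_image_mset minus)
       (use plus in simp)
qed

lemma spectral_expander_seq_doubled_graph:
  assumes d: "d > 0" and H: "spectral_expander_seq d H"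
  shows "spectral_expander_seq (d + 1) (\<lambda>m. doubled_graph (H m))"
proof -
  obtain \<gamma> where \<gamma>: "\<gamma> > 0" "\<And>m. 1 - lambda2 (transition_mat d (H m)) \<ge> \<gamma>"
    using H by (auto simp: spectral_expander_seq_def)
  have reg: "regular_graph d (H m)" for m
    using H by (simp add: spectral_expander_seq_def)
  define \<delta> where "\<delta> = min (real d * \<gamma>) 2 / (real d + 1)"
  have "\<delta> > 0" using \<gamma>(1) d by (simp add: \<delta>_def)
  moreover have "1 - lambda2 (transition_mat (d + 1) (doubled_graph (H m))) \<ge> \<delta>" for m
  proof -
    define l where "l = lambda2 (transition_mat d (H m))"
    have "real d * \<gamma> \<le> real d * (1 - l)"
      using \<gamma>(2)[of m] by (intro mult_left_mono) (simp_all add: l_def)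
    then have "max (real d * l + 1) (real d - 1) \<le> (real d + 1) - min (real d * \<gamma>) 2"
      by (auto simp: algebra_simps max_def min_def)
    then have "max (real d * l + 1) (real d - 1) / (real d + 1) \<le>
        ((real d + 1) - min (real d * \<gamma>) 2) / (real d + 1)"
      by (rule divide_right_mono) simp
    also have "\<dots> = 1 - \<delta>"
      by (simp only: \<delta>_def diff_divide_distrib) simp
    finally have "max (real d * l + 1) (real d - 1) / (real d + 1) \<le> 1 - \<delta>" .
    then show ?thesis
      using lambda2_doubled_graph_le[OF reg[of m] d] by (simp add: l_def)
  qed
  ultimately show ?thesis
    using regular_graph_doubled_graph[OF reg] unfolding spectral_expander_seq_def by blast
qed

section \<open>Balls in regular graphs\<close>

text \<open>
  The vertices with a walk to \<open>v\<close> of at most \<open>r\<close> arcs. The recursion adds one layer at a time, as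
  the counting of spheres does; distances defined as infima are compared with it only at the end.
\<close>

primrec hop_ball :: "('a \<times> 'a) set \<Rightarrow> 'a \<Rightarrow> nat \<Rightarrow> 'a set" where
  "hop_ball E v 0 = {v}"
| "hop_ball E v (Suc r) = hop_ball E v r \<union> E\<inverse> `` hop_ball E v r"

lemma hop_ball_mono: "r \<le> s \<Longrightarrow> hop_ball E v r \<subseteq> hop_ball E v s"
  by (rule lift_Suc_mono_le) auto

lemma hop_ball_subset:
  assumes "pair_graph G" "v \<in> pverts G"
  shows "hop_ball (parcs G) v r \<subseteq> pverts G"
proof -
  interpret pair_graph G by fact
  show ?thesis using assms(2) in_arcsD1 by (induction r) auto
qed

text \<open>
  Each vertex of a sphere of positive radius has a neighbour in the previous ball, which leaves at
  most \<open>k - 1\<close> neighbours in the next sphere. The constant 2 serves the first step, where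
  \<open>k \<le> 2 * (k - 1)\<close>.
\<close>

lemma card_hop_sphere:
  assumes G: "regular_graph k G" and k: "k \<ge> 2" and v: "v \<in> pverts G"
  shows "card (hop_ball (parcs G) v (Suc r) - hop_ball (parcs G) v r) \<le> 2 * (k - 1) ^ Suc r"
proof -
  interpret pair_graph G using G by (simp add: regular_graph_def)
  define B where "B = hop_ball (parcs G) v"
  define N where "N u = {w. (u, w) \<in> parcs G}" for u
  have B_Suc: "B (Suc r) = B r \<union> (parcs G)\<inverse> `` B r" for r
    by (simp add: B_def)
  have B_verts: "B r \<subseteq> pverts G" for r
    using G v by (simp add: B_def hop_ball_subset regular_graph_def)
  have finN: "finite (N u)" for u
    unfolding N_def using pair_finite_verts by (rule rev_finite_subset) (auto dest: in_arcsD2)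
  have cardN: "card (N u) = k" if "u \<in> pverts G" for u
    using card_neighbours[OF G that] by (simp add: N_def)
  have "card (B (Suc r) - B r) \<le> 2 * (k - 1) ^ Suc r"
  proof (induction r)
    case 0
    have "B (Suc 0) - B 0 \<subseteq> N v"
      using arcs_symmetric by (auto simp: B_def N_def)
    then have "card (B (Suc 0) - B 0) \<le> k"
      using card_mono[OF finN] cardN[OF v] by metis
    with k show ?case by simp
  next
    case (Suc r)
    define S where "S = B (Suc r) - B r"
    have finS: "finite S"
      using finite_subset[OF B_verts pair_finite_verts] by (simp add: S_def)
    have "B (Suc (Suc r)) - B (Suc r) \<subseteq> (\<Union>u\<in>S. N u - B r)"
    proof
      fix x assume x: "x \<in> B (Suc (Suc r)) - B (Suc r)"
      then obtain u where u: "u \<in> B (Suc r)" "(x, u) \<in> parcs G"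
        using B_Suc[of "Suc r"] by auto
      with x have "u \<notin> B r" using B_Suc[of r] by auto
      with u x show "x \<in> (\<Union>u\<in>S. N u - B r)"
        using arcs_symmetric B_Suc[of r] by (auto simp: S_def N_def)
    qed
    then have "card (B (Suc (Suc r)) - B (Suc r)) \<le> card (\<Union>u\<in>S. N u - B r)"
      using finS finN by (intro card_mono) auto
    also have "\<dots> \<le> (\<Sum>u\<in>S. card (N u - B r))"
      using finS by (rule card_UN_le)
    also have "\<dots> \<le> (\<Sum>u\<in>S. k - 1)"
    proof (rule sum_mono)
      fix u assume u: "u \<in> S"
      then obtain w where w: "w \<in> B r" "(u, w) \<in> parcs G"
        using B_Suc[of r] by (auto simp: S_def)
      \<comment> \<open>The neighbour \<open>w\<close> in the previous ball is lost.\<close>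
      then have "card (N u - B r) < card (N u)"
        using finN by (intro psubset_card_mono) (auto simp: N_def)
      also have "card (N u) = k"
        using u B_verts by (intro cardN) (auto simp: S_def)
      finally show "card (N u - B r) \<le> k - 1" by simp
    qed
    also have "\<dots> = card S * (k - 1)" by simp
    also have "\<dots> \<le> 2 * (k - 1) ^ Suc r * (k - 1)"
      unfolding S_def using Suc by (rule mult_right_mono) simp
    finally show ?case by (simp add: ac_simps)
  qed
  then show ?thesis by (simp add: B_def)
qed

text \<open>
  The bounds on the spheres form a geometric progression with ratio \<open>k - 1 \<ge> 2\<close>, whose sum is of
  the order of its last term. The constant 4 makes the induction close: \<open>4 q^r \<le> 2 q^(r + 1)\<close> for
  \<open>q \<ge> 2\<close>.
\<close>

lemma card_hop_ball:
  assumes G: "regular_graph k G" and k: "k \<ge> 3" and v: "v \<in> pverts G"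
  shows "card (hop_ball (parcs G) v r) \<le> 4 * (k - 1) ^ r"
proof (induction r)
  case (Suc r)
  interpret pair_graph G using G by (simp add: regular_graph_def)
  let ?B = "hop_ball (parcs G) v"
  have "card (?B (Suc r)) = card (?B r \<union> (?B (Suc r) - ?B r))"
    by (rule arg_cong[of _ _ card]) auto
  also have "\<dots> \<le> card (?B r) + card (?B (Suc r) - ?B r)"
    by (rule card_Un_le)
  also have "\<dots> \<le> 4 * (k - 1) ^ r + 2 * (k - 1) ^ Suc r"
    using Suc card_hop_sphere[OF G _ v, of r] k by (intro add_mono) auto
  also have "4 * (k - 1) ^ r \<le> 2 * (k - 1) ^ Suc r"
    using mult_right_mono[of 2 "k - 1" "(k - 1) ^ r"] k by simp
  finally show ?case by simp
qed simp

section \<open>Balls in the doubled graph\<close>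

text \<open>
  An arc of the doubled graph projects to an arc of \<open>H\<close> or, if it joins the copies, to a single
  vertex; balls increase with the radius, so the latter only wastes a step.
\<close>

lemma pawalk_doubled_graph_hop_ball:
  assumes "wf_digraph (with_proj (doubled_graph H))"
    and "pre_digraph.awalk (with_proj (doubled_graph H)) x p (v, b)"
  shows "fst x \<in> hop_ball (parcs H) v (length p)"
  using assms(2)
proof (induction p arbitrary: x)
  case Nil
  then show ?case
    using wf_digraph.awalk_Nil_iff[OF assms(1)] by (cases x) auto
next
  case (Cons e p)
  then have e: "e \<in> parcs (doubled_graph H)" "x = fst e"
    and "fst (snd e) \<in> hop_ball (parcs H) v (length p)"
    using wf_digraph.awalk_Cons_iff[OF assms(1)] by auto
  then show ?case
    by (cases e; cases "fst e"; cases "snd e") (auto simp: arc_doubled_graph)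
qed

text \<open>
  The distance is an infimum of real walk costs. If it is at most \<open>r\<close>, some walk costs less than
  \<open>r + 1\<close>; costs are integers here, so this walk has at most \<open>r\<close> arcs and can be projected.
\<close>

lemma graph_ball_doubled_graph_subset:
  assumes H: "pair_graph H"
  shows "graph_ball (doubled_graph H) {(v, b)} r \<subseteq> hop_ball (parcs H) v r \<times> UNIV"
proof
  interpret G: pair_graph "doubled_graph H"
    using H by (rule pair_graph_doubled_graph)
  fix x assume "x \<in> graph_ball (doubled_graph H) {(v, b)} r"
  then have "G.\<mu> (\<lambda>_. 1) x (v, b) \<le> ereal (real r)"
    by (simp add: graph_ball_def set_dist_def graph_dist_def)
  also have "ereal (real r) < ereal (real r + 1)" by simp
  finally obtain p where p: "G.awalk x p (v, b)" "G.awalk_cost (\<lambda>_. 1) p < real r + 1"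
    unfolding G.\<mu>_def INF_less_iff by auto
  have "G.awalk_cost (\<lambda>_. 1) p = real (length p)"
    by (simp add: G.awalk_cost_def sum_list_triv)
  with p(2) have "length p \<le> r" by simp
  moreover have "fst x \<in> hop_ball (parcs H) v (length p)"
    using G.wf_digraph_axioms p(1) by (rule pawalk_doubled_graph_hop_ball)
  ultimately show "x \<in> hop_ball (parcs H) v r \<times> UNIV"
    using hop_ball_mono[of "length p" r "parcs H" v] by (cases x) auto
qed

lemma card_graph_ball_doubled_graph:
  assumes G: "regular_graph d H" and d: "d \<ge> 3" and v: "v \<in> pverts H"
  shows "card (graph_ball (doubled_graph H) {(v, b)} r) \<le> 8 * (d - 1) ^ r"
proof -
  interpret pair_graph H using G by (simp add: regular_graph_def)
  have H: "pair_graph H" ..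
  have "finite (hop_ball (parcs H) v r)"
    using hop_ball_subset[OF H v] pair_finite_verts by (rule finite_subset)
  then have "card (graph_ball (doubled_graph H) {(v, b)} r) \<le> card (hop_ball (parcs H) v r \<times> (UNIV :: bool set))"
    by (intro card_mono graph_ball_doubled_graph_subset[OF H]) auto
  also have "\<dots> \<le> 8 * (d - 1) ^ r"
    using card_hop_ball[OF G d v, of r] by (simp add: card_cartesian_product)
  finally show ?thesis .
qed

lemma not_long_range_expander_seq_doubled_graph:
  fixes H :: "nat \<Rightarrow> 'a pair_pre_digraph"
  assumes d: "d \<ge> 3" and H: "\<And>m. regular_graph d (H m)"
    and lim: "filterlim (\<lambda>m. card (pverts (H m))) at_top sequentially"
  shows "\<not> long_range_expander_seq (d + 1) (\<lambda>m. doubled_graph (H m))"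
proof
  assume "long_range_expander_seq (d + 1) (\<lambda>m. doubled_graph (H m))"
  then obtain c where c: "c > 0" "\<And>m. long_range_expander c (d + 1) (doubled_graph (H m))"
    by (auto simp: long_range_expander_seq_def)
  \<comment> \<open>At radius \<open>r\<close> the required growth \<open>c * d^r\<close> outruns the bound \<open>8 * (d - 1)^r\<close>.\<close>
  have "1 < real d / real (d - 1)" using d by simp
  then obtain r where "8 / c < (real d / real (d - 1)) ^ r"
    using real_arch_pow by blast
  then have r: "8 * real (d - 1) ^ r < c * real d ^ r"
    using c(1) d by (simp add: power_divide field_simps)
  \<comment> \<open>With \<open>K\<close> vertices per copy, three quarters of all vertices exceed that bound as well.\<close>
  define K where "K = 8 * (d - 1) ^ r + 1"
  obtain m where m: "K \<le> card (pverts (H m))"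
    using lim by (auto simp: filterlim_at_top eventually_sequentially)
  then have "pverts (H m) \<noteq> {}" by (auto simp: K_def)
  then obtain v where v: "v \<in> pverts (H m)" by blast
  let ?B = "graph_ball (doubled_graph (H m)) {(v, False)} r"
  have "min (3 * real (2 * card (pverts (H m))) / 4) (c * real d ^ r) \<le> real (card ?B)"
    using c(2)[of m] v
    by (auto simp: long_range_expander_def pverts_doubled_graph card_cartesian_product ac_simps
        dest!: spec[of _ "{(v, False)}"])
  also have "real (card ?B) \<le> 8 * real (d - 1) ^ r"
    using of_nat_mono[OF card_graph_ball_doubled_graph[OF H d v, of False r]] by simp
  also have "\<dots> < min (3 * real (2 * card (pverts (H m))) / 4) (c * real d ^ r)"
  proof -
    have "8 * real (d - 1) ^ r < real K" by (simp add: K_def)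
    also have "\<dots> \<le> real (card (pverts (H m)))" using m by simp
    also have "\<dots> \<le> 3 * real (2 * card (pverts (H m))) / 4" by simp
    finally show ?thesis using r by simp
  qed
  finally show False by simp
qed

theorem mainTheorem6:
  fixes d :: nat and H :: "nat \<Rightarrow> 'a pair_pre_digraph"
  assumes "d \<ge> 3"
    and "spectral_expander_seq d H"
    and "filterlim (\<lambda>m. card (pverts (H m))) at_top sequentially"
  shows "spectral_expander_seq (d + 1) (\<lambda>m. doubled_graph (H m)) \<and>
         \<not> long_range_expander_seq (d + 1) (\<lambda>m. doubled_graph (H m))"
proof
  show "spectral_expander_seq (d + 1) (\<lambda>m. doubled_graph (H m))"
    using assms(1,2) by (intro spectral_expander_seq_doubled_graph) auto
  show "\<not> long_range_expander_seq (d + 1) (\<lambda>m. doubled_graph (H m))"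
    using assms by (intro not_long_range_expander_seq_doubled_graph)
      (auto simp: spectral_expander_seq_def)
qed

end
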